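(* Let $A\,|\,B$ be an irreducible extension of $K$-algebras, with $R=A^B$, $S=\mathrm{End}({}_BA_B)$ and $T=(A\otimes_BA)^B$. Let $\tau:S\to S$, $\alpha\mapsto\alpha^\tau=\tau(\alpha)$, be the mapping determined by $$\alpha(t^1)t^2=t^1\alpha^\tau(t^2)\qquad\text{for all }\alpha\in S,\ t=t^1\otimes_Bt^2\in T.$$ Then $\tau$ is an anti-automorphism of the algebra $S$ satisfying $\tau(\rho_r)=\lambda_r$ and $\tau(\lambda_r)=\rho_r$ for all $r\in R$, and $\alpha^\tau(1)=\alpha(1)$ for all $\alpha\in S$.
   Context: $K$ is a commutative ring, $A$ an associative unital $K$-algebra, $B\subseteq A$ a unital subalgebra. For an $A$-$A$-bimodule $M$, $M^B=\{m\in M: bm=mb\ \forall b\in B\}$. $R=A^B$ is the centralizer of $B$ in $A$; $S=\mathrm{End}({}_BA_B)$ is the algebra of $B$-$B$-bimodule endomorphisms of $A$ under composition; elements of $T=(A\otimes_BA)^B$ are written $t=t^1\otimes_Bt^2$ with summation suppressed. For $r\in R$, $\lambda_r,\rho_r\in S$ are $\lambda_r(a)=ra$, $\rho_r(a)=ar$. $A\,|\,B$ is \emph{depth two} if for some positive integer $N$, $A\otimes_BA$ is isomorphic to a direct summand of $A^N$, both as natural $B$-$A$-bimodules and as natural $A$-$B$-bimodules. $A\,|\,B$ is \emph{irreducible} if it is depth two and $R\subseteq B$ (so $R$ is commutative). Why $\tau$ is well defined and bijective: with $R$-bimodule structure $r\cdot t\cdot s=rt^1\otimes t^2s$ on $T$,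 depth two gives bijections $S\to\mathrm{Hom}(T_R,R_R)$, $\alpha\mapsto(t\mapsto\alpha(t^1)t^2)$ and $S\to\mathrm{Hom}({}_RT,{}_RR)$, $\beta\mapsto(t\mapsto t^1\beta(t^2))$, and irreducibility gives $\mathrm{Hom}(T_R,R_R)=\mathrm{Hom}({}_RT,{}_RR)$. *)

theory Defs
  imports Main "HOL-Library.Poly_Mapping"
begin

text \<open>
  The sorts \<open>{comm_ring, comm_monoid_mult}\<close> and \<open>{ring, monoid_mult}\<close> are those of commutative and
  of arbitrary unital rings; unlike \<open>comm_ring_1\<close>, \<open>ring_1\<close> and the library locale \<open>module\<close>,
  they do not exclude the zero ring.
\<close>

locale K_algebra =
  fixes scale :: "'k::{comm_ring, comm_monoid_mult} \<Rightarrow> 'a::{ring, monoid_mult} \<Rightarrow> 'a"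
  assumes scale_right_distrib: "scale k (x + y) = scale k x + scale k y"
    and scale_left_distrib: "scale (k + l) x = scale k x + scale l x"
    and scale_scale: "scale k (scale l x) = scale (k * l) x"
    and scale_one: "scale 1 x = x"
    and scale_mult_left: "scale k (x * y) = scale k x * y"
    and scale_mult_right: "scale k (x * y) = x * scale k y"

definition unital_subalgebra ::
  "('k::{comm_ring, comm_monoid_mult} \<Rightarrow> 'a::{ring, monoid_mult} \<Rightarrow> 'a) \<Rightarrow> 'a set \<Rightarrow> bool" where
  "unital_subalgebra scale B \<longleftrightarrow>
     0 \<in> B \<and> 1 \<in> B \<and> (\<forall>x\<in>B. \<forall>y\<in>B. x + y \<in> B \<and> x * y \<in> B) \<and> (\<forall>k. \<forall>x\<in>B. scale k x \<in> B)"


subsection \<open>Bimodules\<close>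

text \<open>
  The record holds the data of an \<open>A\<close>-\<open>A\<close>-bimodule. Its restriction to a \<open>C\<close>-\<open>D\<close>-bimodule, for
  subrings \<open>C\<close> and \<open>D\<close> of \<open>A\<close>, is expressed by the arguments \<open>C\<close> and \<open>D\<close> of the notions below.
\<close>

record ('a, 'm) bimodule =
  carrier :: "'m set"
  zero :: 'm
  add :: "'m \<Rightarrow> 'm \<Rightarrow> 'm"
  lact :: "'a \<Rightarrow> 'm \<Rightarrow> 'm"
  ract :: "'m \<Rightarrow> 'a \<Rightarrow> 'm"

definition bimod_hom ::
  "'a set \<Rightarrow> 'a set \<Rightarrow> ('a, 'm) bimodule \<Rightarrow> ('a, 'n) bimodule \<Rightarrow> ('m \<Rightarrow> 'n) set" where
  "bimod_hom C D M N = {f.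
     (\<forall>x\<in>carrier M. f x \<in> carrier N) \<and>
     (\<forall>x\<in>carrier M. \<forall>y\<in>carrier M. f (add M x y) = add N (f x) (f y)) \<and>
     (\<forall>c\<in>C. \<forall>x\<in>carrier M. f (lact M c x) = lact N c (f x)) \<and>
     (\<forall>d\<in>D. \<forall>x\<in>carrier M. f (ract M x d) = ract N (f x) d)}"

definition bimod_isomorphic ::
  "'a set \<Rightarrow> 'a set \<Rightarrow> ('a, 'm) bimodule \<Rightarrow> ('a, 'n) bimodule \<Rightarrow> bool" where
  "bimod_isomorphic C D M N \<longleftrightarrow> (\<exists>f\<in>bimod_hom C D M N. bij_betw f (carrier M) (carrier N))"

text \<open>Closure under negation follows from the action of \<open>- 1 \<in> C\<close>.\<close>

definition subbimodule :: "'a set \<Rightarrow> 'a set \<Rightarrow> 'm set \<Rightarrow> ('a, 'm) bimodule \<Rightarrow> bool" where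
  "subbimodule C D P M \<longleftrightarrow> P \<subseteq> carrier M \<and> zero M \<in> P \<and> (\<forall>x\<in>P. \<forall>y\<in>P. add M x y \<in> P) \<and>
     (\<forall>c\<in>C. \<forall>x\<in>P. lact M c x \<in> P) \<and> (\<forall>d\<in>D. \<forall>x\<in>P. ract M x d \<in> P)"

definition direct_summand :: "'a set \<Rightarrow> 'a set \<Rightarrow> 'm set \<Rightarrow> ('a, 'm) bimodule \<Rightarrow> bool" where
  "direct_summand C D P M \<longleftrightarrow> subbimodule C D P M \<and>
     (\<exists>Q. subbimodule C D Q M \<and>
          (\<forall>x\<in>carrier M. \<exists>p\<in>P. \<exists>q\<in>Q. x = add M p q) \<and> P \<inter> Q = {zero M})"

text \<open>\<open>M\<^sup>B\<close>\<close>

definition central_elements :: "('a, 'm) bimodule \<Rightarrow> 'a set \<Rightarrow> 'm set" where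
  "central_elements M B = {m \<in> carrier M. \<forall>b\<in>B. lact M b m = ract M m b}"

definition regular_bimodule :: "('a::{ring, monoid_mult}, 'a) bimodule" where
  "regular_bimodule = \<lparr>carrier = UNIV, zero = 0, add = (+), lact = (*), ract = (*)\<rparr>"

text \<open>\<open>A\<^sup>N\<close>, realised as the functions on \<open>nat\<close> that vanish outside \<open>{..<N}\<close>\<close>

definition power_bimodule :: "nat \<Rightarrow> ('a::{ring, monoid_mult}, nat \<Rightarrow> 'a) bimodule" where
  "power_bimodule N =
     \<lparr>carrier = {f. \<forall>i\<ge>N. f i = 0}, zero = (\<lambda>i. 0), add = (\<lambda>f g i. f i + g i),
      lact = (\<lambda>a f i. a * f i), ract = (\<lambda>f a i. f i * a)\<rparr>"


subsection \<open>The tensor product of \<open>A\<close> with itself over \<open>B\<close>\<close>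

text \<open>
  The quotient of the free abelian group on \<open>A \<times> A\<close> (finitely supported integer-valued functions)
  by the subgroup generated by the relations of biadditivity and \<open>B\<close>-balancedness.
\<close>

inductive_set tensor_null ::
  "'a::{ring, monoid_mult} set \<Rightarrow> ('a \<times> 'a \<Rightarrow>\<^sub>0 int) set" for B :: "'a set" where
  null_zero: "0 \<in> tensor_null B"
| null_diff: "u \<in> tensor_null B \<Longrightarrow> v \<in> tensor_null B \<Longrightarrow> u - v \<in> tensor_null B"
| null_left: "frag_of (x + x', y) - frag_of (x, y) - frag_of (x', y) \<in> tensor_null B"
| null_right: "frag_of (x, y + y') - frag_of (x, y) - frag_of (x, y') \<in> tensor_null B"
| null_balanced: "b \<in> B \<Longrightarrow> frag_of (x * b, y) - frag_of (x, b * y) \<in> tensor_null B"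

definition tensor_rel ::
  "'a::{ring, monoid_mult} set \<Rightarrow> (('a \<times> 'a \<Rightarrow>\<^sub>0 int) \<times> ('a \<times> 'a \<Rightarrow>\<^sub>0 int)) set" where
  "tensor_rel B = {(u, v). u - v \<in> tensor_null B}"

definition frag_lact :: "'a::{ring, monoid_mult} \<Rightarrow> ('a \<times> 'a \<Rightarrow>\<^sub>0 int) \<Rightarrow> ('a \<times> 'a \<Rightarrow>\<^sub>0 int)" where
  "frag_lact a = frag_extend (\<lambda>(x, y). frag_of (a * x, y))"

definition frag_ract :: "('a::{ring, monoid_mult} \<times> 'a \<Rightarrow>\<^sub>0 int) \<Rightarrow> 'a \<Rightarrow> ('a \<times> 'a \<Rightarrow>\<^sub>0 int)" where
  "frag_ract u a = frag_extend (\<lambda>(x, y). frag_of (x, y * a)) u"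

text \<open>
  The operations on classes are given by the usual union over representatives; see
  \<open>tensor_add_class\<close>, \<open>tensor_lact_class\<close> and \<open>tensor_ract_class\<close> below.
\<close>

definition tensor_bimodule ::
  "'a::{ring, monoid_mult} set \<Rightarrow> ('a, ('a \<times> 'a \<Rightarrow>\<^sub>0 int) set) bimodule" where
  "tensor_bimodule B =
     \<lparr>carrier = UNIV // tensor_rel B,
      zero = tensor_rel B `` {0},
      add = (\<lambda>X Y. \<Union>u\<in>X. \<Union>v\<in>Y. tensor_rel B `` {u + v}),
      lact = (\<lambda>a X. \<Union>u\<in>X. tensor_rel B `` {frag_lact a u}),
      ract = (\<lambda>X a. \<Union>u\<in>X. tensor_rel B `` {frag_ract u a})\<rparr>"

text \<open>The element \<open>\<Sum>\<^sub>i x\<^sub>i \<otimes>\<^sub>B y\<^sub>i\<close>, for a finite list of pairs \<open>(x\<^sub>i, y\<^sub>i)\<close>\<close>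

definition tensor_sum ::
  "'a::{ring, monoid_mult} set \<Rightarrow> ('a \<times> 'a) list \<Rightarrow> ('a \<times> 'a \<Rightarrow>\<^sub>0 int) set" where
  "tensor_sum B ps = tensor_rel B `` {\<Sum>p\<leftarrow>ps. frag_of p}"

lemma tensor_null_minus: "u \<in> tensor_null B \<Longrightarrow> - u \<in> tensor_null B"
  using null_diff[OF null_zero] by fastforce

lemma tensor_null_add: "u \<in> tensor_null B \<Longrightarrow> v \<in> tensor_null B \<Longrightarrow> u + v \<in> tensor_null B"
  using null_diff[OF _ tensor_null_minus] by fastforce

lemma equiv_tensor_rel: "equiv UNIV (tensor_rel B)"
proof (rule equivI)
  show "tensor_rel B \<subseteq> UNIV \<times> UNIV" by simp
  show "refl (tensor_rel B)"
    by (auto simp: refl_on_def tensor_rel_def null_zero)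
  show "sym (tensor_rel B)"
    by (auto simp: sym_def tensor_rel_def dest: tensor_null_minus)
  show "trans (tensor_rel B)"
    by (auto simp: trans_def tensor_rel_def dest: tensor_null_add)
qed

lemma frag_lact_null: "u \<in> tensor_null B \<Longrightarrow> frag_lact a u \<in> tensor_null B"
  by (induction rule: tensor_null.induct)
     (auto simp: frag_lact_def frag_extend_diff distrib_left mult.assoc[symmetric]
           intro: tensor_null.intros)

lemma frag_ract_null: "u \<in> tensor_null B \<Longrightarrow> frag_ract u a \<in> tensor_null B"
  by (induction rule: tensor_null.induct)
     (auto simp: frag_ract_def frag_extend_diff distrib_right mult.assoc
           intro: tensor_null.intros)

lemma tensor_add_class:
  "add (tensor_bimodule B) (tensor_rel B `` {u}) (tensor_rel B `` {v}) = tensor_rel B `` {u + v}"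
proof -
  have "congruent2 (tensor_rel B) (tensor_rel B) (\<lambda>u v. tensor_rel B `` {u + v})"
  proof (rule congruent2I')
    fix u u' v v' assume "(u, u') \<in> tensor_rel B" "(v, v') \<in> tensor_rel B"
    then have "(u + v, u' + v') \<in> tensor_rel B"
      using tensor_null_add[of "u - u'" B "v - v'"] by (simp add: tensor_rel_def algebra_simps)
    then show "tensor_rel B `` {u + v} = tensor_rel B `` {u' + v'}"
      by (rule equiv_class_eq[OF equiv_tensor_rel])
  qed
  from UN_equiv_class2[OF equiv_tensor_rel equiv_tensor_rel this] show ?thesis
    by (simp add: tensor_bimodule_def)
qed

lemma tensor_lact_class:
  "lact (tensor_bimodule B) a (tensor_rel B `` {u}) = tensor_rel B `` {frag_lact a u}"
proof -
  have "congruent (tensor_rel B) (\<lambda>u. tensor_rel B `` {frag_lact a u})"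
  proof (rule congruentI)
    fix u v assume "(u, v) \<in> tensor_rel B"
    then have "(frag_lact a u, frag_lact a v) \<in> tensor_rel B"
      using frag_lact_null[of "u - v"] by (simp add: tensor_rel_def frag_lact_def frag_extend_diff)
    then show "tensor_rel B `` {frag_lact a u} = tensor_rel B `` {frag_lact a v}"
      by (rule equiv_class_eq[OF equiv_tensor_rel])
  qed
  from UN_equiv_class[OF equiv_tensor_rel this] show ?thesis
    by (simp add: tensor_bimodule_def)
qed

lemma tensor_ract_class:
  "ract (tensor_bimodule B) (tensor_rel B `` {u}) a = tensor_rel B `` {frag_ract u a}"
proof -
  have "congruent (tensor_rel B) (\<lambda>u. tensor_rel B `` {frag_ract u a})"
  proof (rule congruentI)
    fix u v assume "(u, v) \<in> tensor_rel B"
    then have "(frag_ract u a, frag_ract v a) \<in> tensor_rel B"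
      using frag_ract_null[of "u - v"] by (simp add: tensor_rel_def frag_ract_def frag_extend_diff)
    then show "tensor_rel B `` {frag_ract u a} = tensor_rel B `` {frag_ract v a}"
      by (rule equiv_class_eq[OF equiv_tensor_rel])
  qed
  from UN_equiv_class[OF equiv_tensor_rel this] show ?thesis
    by (simp add: tensor_bimodule_def)
qed


subsection \<open>Depth two and irreducible extensions\<close>

definition centralizer :: "'a::{ring, monoid_mult} set \<Rightarrow> 'a set" where
  "centralizer B = central_elements regular_bimodule B"

definition bimod_End :: "'a::{ring, monoid_mult} set \<Rightarrow> ('a \<Rightarrow> 'a) set" where
  "bimod_End B = bimod_hom B B regular_bimodule regular_bimodule"

definition tensor_central ::
  "'a::{ring, monoid_mult} set \<Rightarrow> ('a \<times> 'a \<Rightarrow>\<^sub>0 int) set set" where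
  "tensor_central B = central_elements (tensor_bimodule B) B"

text \<open>
  Since \<open>B\<close> contains the image of \<open>K\<close>, all these bimodule homomorphisms are automatically
  \<open>K\<close>-linear.
\<close>

definition summand_of_power ::
  "'a::{ring, monoid_mult} set \<Rightarrow> 'a set \<Rightarrow> nat \<Rightarrow> 'a set \<Rightarrow> bool" where
  "summand_of_power C D N B \<longleftrightarrow>
     (\<exists>P. direct_summand C D P (power_bimodule N) \<and>
          bimod_isomorphic C D (tensor_bimodule B) (power_bimodule N\<lparr>carrier := P\<rparr>))"

definition depth_two :: "'a::{ring, monoid_mult} set \<Rightarrow> bool" where
  "depth_two B \<longleftrightarrow> (\<exists>N>0. summand_of_power B UNIV N B \<and> summand_of_power UNIV B N B)"

definition irreducible_extension :: "'a::{ring, monoid_mult} set \<Rightarrow> bool" where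
  "irreducible_extension B \<longleftrightarrow> depth_two B \<and> centralizer B \<subseteq> B"


subsection \<open>The map \<open>\<tau>\<close>\<close>

text \<open>
  \<open>\<alpha>(t\<^sup>1) t\<^sup>2 = t\<^sup>1 \<beta>(t\<^sup>2)\<close> for all \<open>t \<in> T\<close>, where \<open>t = t\<^sup>1 \<otimes> t\<^sup>2\<close> ranges over all
  representations as a finite sum of pure tensors
\<close>

definition tau_related :: "'a::{ring, monoid_mult} set \<Rightarrow> ('a \<Rightarrow> 'a) \<Rightarrow> ('a \<Rightarrow> 'a) \<Rightarrow> bool" where
  "tau_related B \<alpha> \<beta> \<longleftrightarrow>
     (\<forall>ps. tensor_sum B ps \<in> tensor_central B \<longrightarrow>
        (\<Sum>(x, y)\<leftarrow>ps. \<alpha> x * y) = (\<Sum>(x, y)\<leftarrow>ps. x * \<beta> y))"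

definition tau :: "'a::{ring, monoid_mult} set \<Rightarrow> ('a \<Rightarrow> 'a) \<Rightarrow> ('a \<Rightarrow> 'a)" where
  "tau B \<alpha> = (THE \<beta>. \<beta> \<in> bimod_End B \<and> tau_related B \<alpha> \<beta>)"

definition algebra_anti_automorphism ::
  "('k::{comm_ring, comm_monoid_mult} \<Rightarrow> 'a::{ring, monoid_mult} \<Rightarrow> 'a) \<Rightarrow>
   ('a \<Rightarrow> 'a) set \<Rightarrow> (('a \<Rightarrow> 'a) \<Rightarrow> ('a \<Rightarrow> 'a)) \<Rightarrow> bool" where
  "algebra_anti_automorphism scale S \<phi> \<longleftrightarrow>
     bij_betw \<phi> S S \<and>
     (\<forall>\<alpha>\<in>S. \<forall>\<beta>\<in>S. \<phi> (\<lambda>a. \<alpha> a + \<beta> a) = (\<lambda>a. \<phi> \<alpha> a + \<phi> \<beta> a)) \<and>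
     (\<forall>k. \<forall>\<alpha>\<in>S. \<phi> (\<lambda>a. scale k (\<alpha> a)) = (\<lambda>a. scale k (\<phi> \<alpha> a))) \<and>
     (\<forall>\<alpha>\<in>S. \<forall>\<beta>\<in>S. \<phi> (\<alpha> \<circ> \<beta>) = \<phi> \<beta> \<circ> \<phi> \<alpha>) \<and>
     \<phi> id = id"

definition left_mult :: "'a::{ring, monoid_mult} \<Rightarrow> 'a \<Rightarrow> 'a" where
  "left_mult r = (\<lambda>a. r * a)"

definition right_mult :: "'a::{ring, monoid_mult} \<Rightarrow> 'a \<Rightarrow> 'a" where
  "right_mult r = (\<lambda>a. a * r)"

end

theory Submission
  imports Defs HOL.Modules
begin

text \<open>
  Splitting the embeddings of \<open>A \<otimes>\<^sub>B A\<close> into \<open>A\<^sup>N\<close> gives quasi-bases: \<open>t\<^sub>i, u\<^sub>i \<in> T\<close> and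
  \<open>\<gamma>\<^sub>i, \<beta>\<^sub>i \<in> S\<close> with \<open>x \<otimes> y = \<Sum>\<^sub>i t\<^sub>i \<gamma>\<^sub>i(x) y = \<Sum>\<^sub>i x \<beta>\<^sub>i(y) u\<^sub>i\<close>. For \<open>t \<in> T\<close> the elements
  \<open>t\<^sup>1 \<beta>\<^sub>i(t\<^sup>2)\<close> lie in \<open>R \<subseteq> B\<close>, so a \<open>B\<close>-linear \<open>\<alpha>\<close> can be pulled past them:
  \<open>\<alpha>(t\<^sup>1) t\<^sup>2 = \<Sum>\<^sub>i t\<^sup>1 \<beta>\<^sub>i(t\<^sup>2) \<alpha>(u\<^sub>i\<^sup>1) u\<^sub>i\<^sup>2\<close>. Hence \<open>\<alpha>\<^sup>\<tau> = \<Sum>\<^sub>i \<beta>\<^sub>i(-) \<alpha>(u\<^sub>i\<^sup>1) u\<^sub>i\<^sup>2\<close> works; it is the only choice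
  because \<open>\<delta>(y) = \<Sum>\<^sub>i \<beta>\<^sub>i(y) u\<^sub>i\<^sup>1 \<delta>(u\<^sub>i\<^sup>2)\<close> for every \<open>\<delta> \<in> S\<close>. The mirror argument with the \<open>t\<^sub>i\<close> and \<open>\<gamma>\<^sub>i\<close>
  inverts \<open>\<tau>\<close>. Multiplicativity follows by moving first \<open>\<alpha>\<close>, then \<open>\<beta>\<close> to the other leg of the
  central tensors \<open>\<beta>(t\<^sup>1) \<otimes> t\<^sup>2\<close> and \<open>t\<^sup>1 \<otimes> \<alpha>\<^sup>\<tau>(t\<^sup>2)\<close>, and \<open>\<alpha>\<^sup>\<tau>(1) = \<alpha>(1)\<close> is the case \<open>t = 1 \<otimes> 1\<close>.
\<close>

section \<open>Additive extensions to the free abelian group\<close>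

text \<open>\<open>of_int\<close> is not available, since the ring sort includes the zero ring.\<close>

definition int_multiple :: "int \<Rightarrow> 'a::ab_group_add \<Rightarrow> 'a" where
  "int_multiple n x = (\<Sum>i<nat n. x) - (\<Sum>i<nat (- n). x)"

lemma int_multiple_0 [simp]: "int_multiple 0 x = 0"
  and int_multiple_1 [simp]: "int_multiple 1 x = x"
  by (simp_all add: int_multiple_def)

lemma int_multiple_Suc: "int_multiple (n + 1) x = int_multiple n x + x"
proof (cases "n \<ge> 0")
  case True
  then have "nat (n + 1) = Suc (nat n)" "nat (- n) = 0" "nat (- n - 1) = 0" by auto
  then show ?thesis by (simp add: int_multiple_def)
next
  case False
  then have "nat (- n) = Suc (nat (- n - 1))" "nat n = 0" "nat (n + 1) = 0" by auto
  then show ?thesis by (simp add: int_multiple_def)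
qed

lemma int_multiple_add: "int_multiple (m + n) x = int_multiple m x + int_multiple n x"
proof (induction n rule: int_induct[where k = 0])
  case base
  then show ?case by simp
next
  case (step1 n)
  then show ?case using int_multiple_Suc[of "m + n" x] int_multiple_Suc[of n x]
    by (simp add: algebra_simps)
next
  case (step2 n)
  then show ?case using int_multiple_Suc[of "m + n - 1" x] int_multiple_Suc[of "n - 1" x]
    by (simp add: algebra_simps)
qed

text \<open>This is the universal property of the free abelian group on the basis type;
  \<open>frag_additive_eqI\<close> is its uniqueness half.\<close>

definition frag_lift :: "('b \<Rightarrow> 'a::ab_group_add) \<Rightarrow> ('b \<Rightarrow>\<^sub>0 int) \<Rightarrow> 'a" where
  "frag_lift f u = (\<Sum>p\<in>Poly_Mapping.keys u. int_multiple (Poly_Mapping.lookup u p) (f p))"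

lemma frag_lift_of [simp]: "frag_lift f (frag_of p) = f p"
  by (simp add: frag_lift_def)

lemma additive_frag_lift:
  fixes f :: "'b \<Rightarrow> 'a::ab_group_add"
  shows "additive (frag_lift f)"
proof
  fix u v :: "'b \<Rightarrow>\<^sub>0 int"
  \<comment> \<open>Coefficients may cancel in u + v, so its support can be smaller than the union
    of the two supports. All three sums are taken over that union, where the extra terms
    vanish.\<close>
  have *: "frag_lift f w = (\<Sum>p\<in>Poly_Mapping.keys u \<union> Poly_Mapping.keys v. int_multiple (Poly_Mapping.lookup w p) (f p))"
    if "Poly_Mapping.keys w \<subseteq> Poly_Mapping.keys u \<union> Poly_Mapping.keys v" for w
    unfolding frag_lift_def using that
    by (intro sum.mono_neutral_left) (auto simp: in_keys_iff)
  show "frag_lift f (u + v) = frag_lift f u + frag_lift f v"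
    using keys_add[of u v] by (simp add: * Poly_Mapping.lookup_add int_multiple_add sum.distrib)
qed

lemma additive_frag_extend: "additive (frag_extend f)"
  by standard (rule frag_extend_add)

lemma frag_additive_eqI:
  assumes "additive F" "additive G" "\<And>p. F (frag_of p) = G (frag_of p)"
  shows "F u = G u"
  using subset_UNIV
  by (induction u rule: frag_induction)
     (simp_all add: assms(3) additive.zero[OF assms(1)] additive.zero[OF assms(2)]
        additive.diff[OF assms(1)] additive.diff[OF assms(2)])

text \<open>This is multiplication after \<alpha> \<otimes> \<beta>. It lives on the free group
  because for arbitrary maps it does not descend to the tensor product over B. The two sides of the
  relation defining tau are \<open>frag_eval \<alpha> id\<close> and
  \<open>frag_eval id \<beta>\<close>.\<close>

definition frag_eval :: "('a \<Rightarrow> 'a) \<Rightarrow> ('a \<Rightarrow> 'a) \<Rightarrow> ('a::{ring, monoid_mult} \<times> 'a \<Rightarrow>\<^sub>0 int) \<Rightarrow> 'a" where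
  "frag_eval \<alpha> \<beta> = frag_lift (\<lambda>(x, y). \<alpha> x * \<beta> y)"

definition frag_map :: "('a \<Rightarrow> 'a) \<Rightarrow> ('a \<Rightarrow> 'a) \<Rightarrow> ('a \<times> 'a \<Rightarrow>\<^sub>0 int) \<Rightarrow> ('a \<times> 'a \<Rightarrow>\<^sub>0 int)" where
  "frag_map \<alpha> \<beta> = frag_extend (\<lambda>(x, y). frag_of (\<alpha> x, \<beta> y))"

lemma additive_frag_eval: "additive (frag_eval \<alpha> \<beta>)"
  unfolding frag_eval_def by (rule additive_frag_lift)

lemma additive_frag_map: "additive (frag_map \<alpha> \<beta>)"
  unfolding frag_map_def by (rule additive_frag_extend)

lemma frag_eval_of [simp]: "frag_eval \<alpha> \<beta> (frag_of (x, y)) = \<alpha> x * \<beta> y"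
  by (simp add: frag_eval_def)

lemma frag_map_of [simp]: "frag_map \<alpha> \<beta> (frag_of (x, y)) = frag_of (\<alpha> x, \<beta> y)"
  by (simp add: frag_map_def)

lemmas frag_eval_diff [simp] = additive.diff[OF additive_frag_eval]
lemmas frag_eval_add [simp] = additive.add[OF additive_frag_eval]
lemmas frag_eval_zero [simp] = additive.zero[OF additive_frag_eval]
lemmas frag_eval_sum = additive.sum[OF additive_frag_eval]
lemmas frag_map_diff [simp] = additive.diff[OF additive_frag_map]
lemmas frag_map_zero [simp] = additive.zero[OF additive_frag_map]

lemma frag_lact_eq_map: "frag_lact a = frag_map (left_mult a) id"
  by (simp add: frag_lact_def frag_map_def left_mult_def id_def)

lemma frag_ract_eq_map: "frag_ract u a = frag_map id (right_mult a) u"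
  by (simp add: frag_ract_def frag_map_def right_mult_def id_def)

lemma frag_eval_frag_map: "frag_eval \<alpha> \<beta> (frag_map \<gamma> \<delta> u) = frag_eval (\<alpha> \<circ> \<gamma>) (\<beta> \<circ> \<delta>) u"
  using subset_UNIV by (induction u rule: frag_induction) auto

lemma frag_map_frag_map: "frag_map \<alpha> \<beta> (frag_map \<gamma> \<delta> u) = frag_map (\<alpha> \<circ> \<gamma>) (\<beta> \<circ> \<delta>) u"
  using subset_UNIV by (induction u rule: frag_induction) auto

lemma frag_eval_mult_left: "frag_eval (\<lambda>x. a * \<alpha> x) \<beta> u = a * frag_eval \<alpha> \<beta> u"
  using subset_UNIV by (induction u rule: frag_induction) (auto simp: right_diff_distrib mult.assoc)

lemma frag_eval_mult_right: "frag_eval \<alpha> (\<lambda>y. \<beta> y * a) u = frag_eval \<alpha> \<beta> u * a"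
  using subset_UNIV by (induction u rule: frag_induction) (auto simp: left_diff_distrib mult.assoc)

lemma frag_eval_sum_left: "frag_eval (\<lambda>x. \<Sum>i\<in>I. \<alpha> i x) \<beta> u = (\<Sum>i\<in>I. frag_eval (\<alpha> i) \<beta> u)"
  using subset_UNIV
  by (induction u rule: frag_induction) (auto simp: sum_distrib_right sum_subtractf)

lemma frag_eval_sum_right: "frag_eval \<alpha> (\<lambda>y. \<Sum>i\<in>I. \<beta> i y) u = (\<Sum>i\<in>I. frag_eval \<alpha> (\<beta> i) u)"
  using subset_UNIV
  by (induction u rule: frag_induction) (auto simp: sum_distrib_left sum_subtractf)

lemma frag_eval_add_left: "frag_eval (\<lambda>x. \<alpha> x + \<alpha>' x) \<beta> u = frag_eval \<alpha> \<beta> u + frag_eval \<alpha>' \<beta> u"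
  using subset_UNIV by (induction u rule: frag_induction) (auto simp: algebra_simps)

lemma frag_eval_add_right: "frag_eval \<alpha> (\<lambda>y. \<beta> y + \<beta>' y) u = frag_eval \<alpha> \<beta> u + frag_eval \<alpha> \<beta>' u"
  using subset_UNIV by (induction u rule: frag_induction) (auto simp: algebra_simps)

lemma frag_eval_frag_lact: "frag_eval \<alpha> \<beta> (frag_lact a u) = frag_eval (\<lambda>x. \<alpha> (a * x)) \<beta> u"
  by (simp add: frag_lact_eq_map frag_eval_frag_map left_mult_def comp_def)

lemma frag_eval_frag_ract: "frag_eval \<alpha> \<beta> (frag_ract u a) = frag_eval \<alpha> (\<lambda>y. \<beta> (y * a)) u"
  by (simp add: frag_ract_eq_map frag_eval_frag_map right_mult_def comp_def)

lemma frag_eval_sum_list: "(\<Sum>(x, y)\<leftarrow>ps. \<alpha> x * \<beta> y) = frag_eval \<alpha> \<beta> (\<Sum>p\<leftarrow>ps. frag_of p)"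
  by (induction ps) auto

lemma bimod_End_iff:
  "\<alpha> \<in> bimod_End B \<longleftrightarrow>
     (\<forall>x y. \<alpha> (x + y) = \<alpha> x + \<alpha> y) \<and> (\<forall>b\<in>B. \<forall>x. \<alpha> (b * x) = b * \<alpha> x \<and> \<alpha> (x * b) = \<alpha> x * b)"
  by (auto simp: bimod_End_def bimod_hom_def regular_bimodule_def)

lemma centralizer_iff: "r \<in> centralizer B \<longleftrightarrow> (\<forall>b\<in>B. b * r = r * b)"
  by (simp add: centralizer_def central_elements_def regular_bimodule_def)

text \<open>Endomorphisms in S make the evaluation balanced: \<alpha>(x b) \<beta>(y) = \<alpha>(x)
  b \<beta>(y) = \<alpha>(x) \<beta>(b y). Biadditivity comes from additivity of both maps.\<close>

lemma frag_eval_null: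
  assumes "\<alpha> \<in> bimod_End B" "\<beta> \<in> bimod_End B" "u \<in> tensor_null B"
  shows "frag_eval \<alpha> \<beta> u = 0"
  using assms(3)
  by (induction rule: tensor_null.induct)
     (use assms(1,2) in \<open>auto simp: bimod_End_iff algebra_simps\<close>)

lemma frag_map_null:
  assumes "\<alpha> \<in> bimod_End B" "\<beta> \<in> bimod_End B" "u \<in> tensor_null B"
  shows "frag_map \<alpha> \<beta> u \<in> tensor_null B"
  using assms(3)
  by (induction rule: tensor_null.induct)
     (use assms(1,2) in \<open>auto simp: bimod_End_iff intro: tensor_null.intros\<close>)

section \<open>Central tensors\<close>

abbreviation tensor_class :: "'a::{ring, monoid_mult} set \<Rightarrow> ('a \<times> 'a \<Rightarrow>\<^sub>0 int) \<Rightarrow> ('a \<times> 'a \<Rightarrow>\<^sub>0 int) set" where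
  "tensor_class B u \<equiv> tensor_rel B `` {u}"

lemma tensor_class_eq_iff: "tensor_class B u = tensor_class B v \<longleftrightarrow> u - v \<in> tensor_null B"
  using eq_equiv_class_iff[OF equiv_tensor_rel, of u v B] by (simp add: tensor_rel_def)

lemma tensor_class_in_carrier [simp]: "tensor_class B u \<in> carrier (tensor_bimodule B)"
  by (simp add: tensor_bimodule_def quotientI)

lemma carrier_tensorE:
  assumes "X \<in> carrier (tensor_bimodule B)"
  obtains u where "X = tensor_class B u"
  using assms by (auto simp: tensor_bimodule_def elim!: quotientE)

text \<open>Membership in T is expressed on representatives, so that later arguments compute in the
  free group instead of with classes.\<close>

definition frag_central :: "'a::{ring, monoid_mult} set \<Rightarrow> ('a \<times> 'a \<Rightarrow>\<^sub>0 int) \<Rightarrow> bool" where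
  "frag_central B u \<longleftrightarrow> (\<forall>b\<in>B. frag_lact b u - frag_ract u b \<in> tensor_null B)"

lemma tensor_class_central_iff: "tensor_class B u \<in> tensor_central B \<longleftrightarrow> frag_central B u"
  by (simp add: tensor_central_def central_elements_def tensor_lact_class tensor_ract_class
      tensor_class_eq_iff frag_central_def)

lemma frag_central_null:
  assumes "u - v \<in> tensor_null B" "frag_central B u"
  shows "frag_central B v"
  using assms tensor_class_eq_iff tensor_class_central_iff by metis

text \<open>The relation for 0 + 0 makes 0 \<otimes> y null, and adding it to the relation for x +
  (- x) cancels the term \<open>frag_of (0, y)\<close>.\<close>

lemma tensor_null_uminus_left: "frag_of (x, y) + frag_of (- x, y) \<in> tensor_null B"
proof -
  have "frag_of (0 + 0, y) - frag_of (0, y) - frag_of (0, y) \<in> tensor_null B"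
    by (rule null_left)
  moreover have "frag_of (x + - x, y) - frag_of (x, y) - frag_of (- x, y) \<in> tensor_null B"
    by (rule null_left)
  ultimately have "(frag_of (0 + 0, y) - frag_of (0, y) - frag_of (0, y)) +
      (frag_of (x + - x, y) - frag_of (x, y) - frag_of (- x, y)) \<in> tensor_null B"
    by (rule tensor_null_add)
  from tensor_null_minus[OF this] show ?thesis by (simp add: add.commute)
qed

text \<open>Integer coefficients reduce to a list of pure tensors because a minus sign can be
  absorbed into the first leg. This connects the free group with \<open>tau_related\<close>, which
  quantifies over lists.\<close>

lemma frag_list_representation: "\<exists>ps. u - (\<Sum>p\<leftarrow>ps. frag_of p) \<in> tensor_null B"
  using subset_UNIV
proof (induction u rule: frag_induction)
  case zero
  show ?case by (rule exI[of _ "[]"]) (simp add: null_zero)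
next
  case (one p)
  show ?case by (rule exI[of _ "[p]"]) (simp add: null_zero)
next
  case (diff u v)
  then obtain ps qs where "u - (\<Sum>p\<leftarrow>ps. frag_of p) \<in> tensor_null B"
    and "v - (\<Sum>p\<leftarrow>qs. frag_of p) \<in> tensor_null B" by blast
  then have 1: "(u - (\<Sum>p\<leftarrow>ps. frag_of p)) - (v - (\<Sum>p\<leftarrow>qs. frag_of p)) \<in> tensor_null B"
    by (rule null_diff)
  have "(\<Sum>p\<leftarrow>qs. frag_of p) + (\<Sum>p\<leftarrow>map (\<lambda>(x, y). (- x, y)) qs. frag_of p) \<in> tensor_null B"
  proof (induction qs)
    case (Cons q qs)
    then show ?case
      using tensor_null_add[OF tensor_null_uminus_left[of "fst q" "snd q" B] Cons]
      by (auto simp: case_prod_beta algebra_simps)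
  qed (simp add: null_zero)
  from null_diff[OF 1 this] show ?case
    by (intro exI[of _ "ps @ map (\<lambda>(x, y). (- x, y)) qs"]) (simp add: algebra_simps)
qed

text \<open>Both evaluations depend only on the class of u, as does centrality, so u may be replaced
  by a list of pure tensors representing the same class.\<close>

lemma tau_related_iff:
  assumes "\<alpha> \<in> bimod_End B" "\<beta> \<in> bimod_End B"
  shows "tau_related B \<alpha> \<beta> \<longleftrightarrow> (\<forall>u. frag_central B u \<longrightarrow> frag_eval \<alpha> id u = frag_eval id \<beta> u)"
proof -
  have id: "id \<in> bimod_End B" by (simp add: bimod_End_iff)
  have lists: "tau_related B \<alpha> \<beta> \<longleftrightarrow> (\<forall>ps. frag_central B (\<Sum>p\<leftarrow>ps. frag_of p) \<longrightarrow>
      frag_eval \<alpha> id (\<Sum>p\<leftarrow>ps. frag_of p) = frag_eval id \<beta> (\<Sum>p\<leftarrow>ps. frag_of p))"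
    unfolding tau_related_def tensor_sum_def tensor_class_central_iff
    by (simp flip: frag_eval_sum_list)
  show ?thesis
  proof
    assume rel: "tau_related B \<alpha> \<beta>"
    show "\<forall>u. frag_central B u \<longrightarrow> frag_eval \<alpha> id u = frag_eval id \<beta> u"
    proof (intro allI impI)
      fix u assume "frag_central B u"
      moreover obtain ps where ps: "u - (\<Sum>p\<leftarrow>ps. frag_of p) \<in> tensor_null B"
        using frag_list_representation by blast
      ultimately have "frag_eval \<alpha> id (\<Sum>p\<leftarrow>ps. frag_of p) = frag_eval id \<beta> (\<Sum>p\<leftarrow>ps. frag_of p)"
        using lists rel frag_central_null by blast
      with frag_eval_null[OF assms(1) id ps] frag_eval_null[OF id assms(2) ps]
      show "frag_eval \<alpha> id u = frag_eval id \<beta> u" by simp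
    qed
  qed (simp add: lists)
qed

section \<open>Depth two quasi-bases\<close>

lemma power_bimodule_simps [simp]:
  "carrier (power_bimodule N) = {f. \<forall>i\<ge>N. f i = 0}" "zero (power_bimodule N) = (\<lambda>i. 0)"
  "add (power_bimodule N) f g = (\<lambda>i. f i + g i)"
  "lact (power_bimodule N) a f = (\<lambda>i. a * f i)" "ract (power_bimodule N) f a = (\<lambda>i. f i * a)"
  by (simp_all add: power_bimodule_def)

text \<open>The map is the projection onto P along a complement Q. Since - 1 acts from C, both are
  closed under differences, so the trivial intersection makes the components of a vector
  unique.\<close>

lemma direct_summand_projection:
  fixes C D :: "'a::{ring, monoid_mult} set"
  assumes "direct_summand C D P (power_bimodule N)" "- 1 \<in> C"
  obtains \<pi> where "\<pi> \<in> bimod_hom C D (power_bimodule N) (power_bimodule N\<lparr>carrier := P\<rparr>)"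
    and "\<And>x. x \<in> P \<Longrightarrow> \<pi> x = x"
proof -
  obtain Q where P: "subbimodule C D P (power_bimodule N)"
    and Q: "subbimodule C D Q (power_bimodule N)"
    and PQ: "\<And>x. x \<in> carrier (power_bimodule N) \<Longrightarrow> \<exists>p\<in>P. \<exists>q\<in>Q. x = (\<lambda>i. p i + q i)"
    and disj: "P \<inter> Q = {\<lambda>i. 0}"
    using assms(1) unfolding direct_summand_def power_bimodule_simps(2,3) by blast
  have closed: "(\<lambda>i. x i + y i) \<in> R" "c \<in> C \<Longrightarrow> (\<lambda>i. c * x i) \<in> R" "d \<in> D \<Longrightarrow> (\<lambda>i. x i * d) \<in> R"
    if "subbimodule C D R (power_bimodule N)" "x \<in> R" "y \<in> R" for R x y c d
    using that unfolding subbimodule_def power_bimodule_simps by blast+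
  have diff: "(\<lambda>i. x i - y i) \<in> R" if R: "subbimodule C D R (power_bimodule N)" "x \<in> R" "y \<in> R" for R x y
  proof -
    have "(\<lambda>i. - 1 * y i) \<in> R" by (rule closed(2)[OF R(1,3,3) assms(2)])
    from closed(1)[OF R(1,2) this] show ?thesis by simp
  qed
  have uniq: "p = p'" if "p \<in> P" "p' \<in> P" "q \<in> Q" "q' \<in> Q"
    "(\<lambda>i. p i + q i) = (\<lambda>i. p' i + q' i)" for p p' q q'
  proof -
    have "(\<lambda>i. p i - p' i) = (\<lambda>i. q' i - q i)"
      using that(5) by (auto simp: fun_eq_iff algebra_simps)
    then have "(\<lambda>i. p i - p' i) \<in> P \<inter> Q"
      using diff[OF P that(1,2)] diff[OF Q that(4,3)] by simp
    then show ?thesis by (simp add: disj fun_eq_iff)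
  qed
  have sub: "P \<subseteq> carrier (power_bimodule N)" "Q \<subseteq> carrier (power_bimodule N)"
    using P Q unfolding subbimodule_def by blast+
  \<comment> \<open>The choice is harmless by uniqueness: to compute \<pi> at a vector it suffices
    to exhibit one decomposition, which is how each linearity condition below is checked.\<close>
  define \<pi> where "\<pi> x = (SOME p. p \<in> P \<and> (\<exists>q\<in>Q. x = (\<lambda>i. p i + q i)))" for x
  have \<pi>_ex: "\<pi> x \<in> P \<and> (\<exists>q\<in>Q. x = (\<lambda>i. \<pi> x i + q i))" if "x \<in> carrier (power_bimodule N)" for x
  proof -
    have "\<exists>p. p \<in> P \<and> (\<exists>q\<in>Q. x = (\<lambda>i. p i + q i))" using PQ[OF that] by blast
    from someI_ex[OF this] show ?thesis unfolding \<pi>_def .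
  qed
  have \<pi>_eq: "\<pi> x = p" if "p \<in> P" "q \<in> Q" "x = (\<lambda>i. p i + q i)" for x p q
  proof -
    have "x \<in> carrier (power_bimodule N)"
      using subsetD[OF sub(1) that(1)] subsetD[OF sub(2) that(2)] by (simp add: that(3))
    from \<pi>_ex[OF this] obtain q' where q': "\<pi> x \<in> P" "q' \<in> Q" "x = (\<lambda>i. \<pi> x i + q' i)" by blast
    show ?thesis by (rule uniq[OF q'(1) that(1) q'(2) that(2) trans[OF q'(3)[symmetric] that(3)]])
  qed
  show thesis
  proof
    show "\<pi> x = x" if "x \<in> P" for x
      using that disj by (intro \<pi>_eq[of _ "\<lambda>i. 0"]) auto
    show "\<pi> \<in> bimod_hom C D (power_bimodule N) (power_bimodule N\<lparr>carrier := P\<rparr>)"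
      unfolding bimod_hom_def
    proof (intro CollectI conjI ballI)
      fix x :: "nat \<Rightarrow> 'a" assume x: "x \<in> carrier (power_bimodule N)"
      then obtain q where px: "\<pi> x \<in> P" and q: "q \<in> Q" and xq: "x = (\<lambda>i. \<pi> x i + q i)"
        using \<pi>_ex by blast
      show "\<pi> x \<in> carrier (power_bimodule N\<lparr>carrier := P\<rparr>)" using px by simp
      show "\<pi> (lact (power_bimodule N) c x) = lact (power_bimodule N\<lparr>carrier := P\<rparr>) c (\<pi> x)"
        if "c \<in> C" for c
      proof -
        have "\<pi> (\<lambda>i. c * x i) = (\<lambda>i. c * \<pi> x i)"
        proof (rule \<pi>_eq)
          show "(\<lambda>i. c * \<pi> x i) \<in> P" "(\<lambda>i. c * q i) \<in> Q"
            using closed[OF P px px] closed[OF Q q q] that by blast+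
          show "(\<lambda>i. c * x i) = (\<lambda>i. c * \<pi> x i + c * q i)"
            by (subst xq) (simp add: distrib_left)
        qed
        then show ?thesis by (simp add: power_bimodule_def)
      qed
      show "\<pi> (ract (power_bimodule N) x d) = ract (power_bimodule N\<lparr>carrier := P\<rparr>) (\<pi> x) d"
        if "d \<in> D" for d
      proof -
        have "\<pi> (\<lambda>i. x i * d) = (\<lambda>i. \<pi> x i * d)"
        proof (rule \<pi>_eq)
          show "(\<lambda>i. \<pi> x i * d) \<in> P" "(\<lambda>i. q i * d) \<in> Q"
            using closed[OF P px px] closed[OF Q q q] that by blast+
          show "(\<lambda>i. x i * d) = (\<lambda>i. \<pi> x i * d + q i * d)"
            by (subst xq) (simp add: distrib_right)
        qed
        then show ?thesis by (simp add: power_bimodule_def)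
      qed
      fix y :: "nat \<Rightarrow> 'a" assume y: "y \<in> carrier (power_bimodule N)"
      then obtain q' where py: "\<pi> y \<in> P" and q': "q' \<in> Q" and yq: "y = (\<lambda>i. \<pi> y i + q' i)"
        using \<pi>_ex by blast
      have "\<pi> (\<lambda>i. x i + y i) = (\<lambda>i. \<pi> x i + \<pi> y i)"
      proof (rule \<pi>_eq)
        show "(\<lambda>i. \<pi> x i + \<pi> y i) \<in> P" "(\<lambda>i. q i + q' i) \<in> Q"
          using closed(1)[OF P px py] closed(1)[OF Q q q'] by blast+
        show "(\<lambda>i. x i + y i) = (\<lambda>i. \<pi> x i + \<pi> y i + (q i + q' i))"
          by (subst xq, subst yq) (simp add: algebra_simps)
      qed
      then show "\<pi> (add (power_bimodule N) x y) = add (power_bimodule N\<lparr>carrier := P\<rparr>) (\<pi> x) (\<pi> y)"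
        by (simp add: power_bimodule_def)
    qed
  qed
qed

lemma tensor_bimodule_closed:
  assumes "X \<in> carrier (tensor_bimodule B)"
  shows "Y \<in> carrier (tensor_bimodule B) \<Longrightarrow> add (tensor_bimodule B) X Y \<in> carrier (tensor_bimodule B)"
    and "lact (tensor_bimodule B) a X \<in> carrier (tensor_bimodule B)"
    and "ract (tensor_bimodule B) X a \<in> carrier (tensor_bimodule B)"
  using assms
  by (auto elim!: carrier_tensorE simp: tensor_add_class tensor_lact_class tensor_ract_class)

text \<open>The retraction g is the projection onto the summand followed by the inverse of the
  isomorphism.\<close>

lemma summand_retraction:
  assumes "summand_of_power C D N B" "- 1 \<in> C"
  obtains f g where "f \<in> bimod_hom C D (tensor_bimodule B) (power_bimodule N)"
    and "g \<in> bimod_hom C D (power_bimodule N) (tensor_bimodule B)"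
    and "\<And>X. X \<in> carrier (tensor_bimodule B) \<Longrightarrow> g (f X) = X"
proof -
  let ?T = "tensor_bimodule B"
  obtain P f where P: "direct_summand C D P (power_bimodule N)"
    and f: "f \<in> bimod_hom C D ?T (power_bimodule N\<lparr>carrier := P\<rparr>)"
    and bij: "bij_betw f (carrier ?T) P"
    using assms(1) unfolding summand_of_power_def bimod_isomorphic_def by auto
  obtain \<pi> where \<pi>: "\<pi> \<in> bimod_hom C D (power_bimodule N) (power_bimodule N\<lparr>carrier := P\<rparr>)"
    and \<pi>_P: "\<And>x. x \<in> P \<Longrightarrow> \<pi> x = x"
    using direct_summand_projection[OF P assms(2)] by blast
  define h where "h = inv_into (carrier ?T) f"
  have h: "h p \<in> carrier ?T" "f (h p) = p" if "p \<in> P" for p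
    using that bij unfolding h_def bij_betw_def by (auto simp: inv_into_into f_inv_into_f)
  have hf: "h (f X) = X" if "X \<in> carrier ?T" for X
    using that bij unfolding h_def bij_betw_def by auto
  \<comment> \<open>An equation for h is verified after applying f, so linearity of h is inherited
    from f.\<close>
  have h_eq: "h p = X" if "X \<in> carrier ?T" "f X = p" for p X
    using hf that by blast
  have fP: "f X \<in> P" if "X \<in> carrier ?T" for X
    using that bij bij_betwE by blast
  have \<pi>': "\<pi> x \<in> P" if "x \<in> carrier (power_bimodule N)" for x
    using \<pi> that by (simp add: bimod_hom_def)
  have sub: "P \<subseteq> carrier (power_bimodule N)"
    using P by (simp add: direct_summand_def subbimodule_def)
  have ops: "add (power_bimodule N\<lparr>carrier := P\<rparr>) = add (power_bimodule N)"
    "lact (power_bimodule N\<lparr>carrier := P\<rparr>) = lact (power_bimodule N)"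
    "ract (power_bimodule N\<lparr>carrier := P\<rparr>) = ract (power_bimodule N)"
    by (simp_all add: power_bimodule_def)
  show thesis
  proof (rule that)
    show "f \<in> bimod_hom C D ?T (power_bimodule N)"
      using f fP sub unfolding bimod_hom_def ops by blast
    show "h (\<pi> (f X)) = X" if "X \<in> carrier ?T" for X
      using that by (simp add: \<pi>_P fP hf)
    have "h (\<pi> x) \<in> carrier ?T" if "x \<in> carrier (power_bimodule N)" for x
      using h \<pi>' that by blast
    moreover have "h (\<pi> (add (power_bimodule N) x y)) = add ?T (h (\<pi> x)) (h (\<pi> y))"
      if "x \<in> carrier (power_bimodule N)" "y \<in> carrier (power_bimodule N)" for x y
      using that f \<pi> \<pi>' h unfolding bimod_hom_def ops
      by (intro h_eq) (auto intro: tensor_bimodule_closed simp del: power_bimodule_simps)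
    moreover have "h (\<pi> (lact (power_bimodule N) c x)) = lact ?T c (h (\<pi> x))"
      if "c \<in> C" "x \<in> carrier (power_bimodule N)" for c x
      using that f \<pi> \<pi>' h unfolding bimod_hom_def ops
      by (intro h_eq) (auto intro: tensor_bimodule_closed simp del: power_bimodule_simps)
    moreover have "h (\<pi> (ract (power_bimodule N) x d)) = ract ?T (h (\<pi> x)) d"
      if "d \<in> D" "x \<in> carrier (power_bimodule N)" for d x
      using that f \<pi> \<pi>' h unfolding bimod_hom_def ops
      by (intro h_eq) (auto intro: tensor_bimodule_closed simp del: power_bimodule_simps)
    ultimately show "(\<lambda>x. h (\<pi> x)) \<in> bimod_hom C D (power_bimodule N) ?T"
      unfolding bimod_hom_def by blast
  qed
qed

section \<open>Coordinates with respect to the unit vectors\<close>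

definition unit_vector :: "nat \<Rightarrow> nat \<Rightarrow> 'a::{ring, monoid_mult}" where
  "unit_vector i = (\<lambda>j. if j = i then 1 else 0)"

lemma tensor_class_add:
  "tensor_class B (u + v) = add (tensor_bimodule B) (tensor_class B u) (tensor_class B v)"
  by (simp add: tensor_add_class)

lemma bimod_hom_add:
  "f \<in> bimod_hom C D M N \<Longrightarrow> x \<in> carrier M \<Longrightarrow> y \<in> carrier M \<Longrightarrow> f (add M x y) = add N (f x) (f y)"
  and bimod_hom_lact: "f \<in> bimod_hom C D M N \<Longrightarrow> x \<in> carrier M \<Longrightarrow> c \<in> C \<Longrightarrow> f (lact M c x) = lact N c (f x)"
  and bimod_hom_ract: "f \<in> bimod_hom C D M N \<Longrightarrow> x \<in> carrier M \<Longrightarrow> d \<in> D \<Longrightarrow> f (ract M x d) = ract N (f x) d"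
  and bimod_hom_carrier: "f \<in> bimod_hom C D M N \<Longrightarrow> x \<in> carrier M \<Longrightarrow> f x \<in> carrier N"
  by (simp_all add: bimod_hom_def)

text \<open>A vector is the sum of its coordinate vectors, split off one at a time from the last.
  The family \<open>a\<close> leaves open on which side the coordinates act, so that both kinds of
  quasi-basis are covered.\<close>

lemma hom_from_power_expansion:
  fixes a :: "nat \<Rightarrow> 'a::{ring, monoid_mult} \<Rightarrow> ('a \<times> 'a \<Rightarrow>\<^sub>0 int)"
  assumes g: "g \<in> bimod_hom C D (power_bimodule N) (tensor_bimodule B)"
    and unit: "\<And>i c. i < N \<Longrightarrow> g (\<lambda>j. if j = i then c else 0) = tensor_class B (a i c)"
    and v: "v \<in> carrier (power_bimodule N)"
  shows "g v = tensor_class B (\<Sum>i<N. a i (v i))"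
proof -
  have "g v = tensor_class B (\<Sum>i<n. a i (v i))" if "n \<le> N" "\<forall>i\<ge>n. v i = 0" for n v
    using that
  proof (induction n arbitrary: v)
    case 0
    \<comment> \<open>Preservation of zero is not part of \<open>bimod_hom\<close>; it follows from
      g(0) = g(0) + g(0).\<close>
    obtain w where w: "g (\<lambda>i. 0) = tensor_class B w"
      using bimod_hom_carrier[OF g, of "\<lambda>i. 0"] by (auto elim: carrier_tensorE)
    have "g (\<lambda>i. 0) = add (tensor_bimodule B) (g (\<lambda>i. 0)) (g (\<lambda>i. 0))"
      using bimod_hom_add[OF g, of "\<lambda>i. 0" "\<lambda>i. 0"] by simp
    then have "tensor_class B (w + w) = tensor_class B w"
      by (simp add: w tensor_add_class)
    then have "w - 0 \<in> tensor_null B" by (simp add: tensor_class_eq_iff)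
    then have "tensor_class B w = tensor_class B 0" by (simp only: tensor_class_eq_iff)
    moreover have "v = (\<lambda>i. 0)" using 0 by auto
    ultimately show ?case by (simp add: w)
  next
    case (Suc n)
    define v' where "v' = v(n := 0)"
    let ?e = "\<lambda>j. if j = n then v n else 0"
    have v'0: "\<forall>i\<ge>n. v' i = 0"
      using Suc.prems(2) by (auto simp: v'_def Suc_le_eq)
    have "v = (\<lambda>i. v' i + ?e i)" by (auto simp: v'_def)
    then have "g v = g (add (power_bimodule N) v' ?e)" by simp
    also have "\<dots> = add (tensor_bimodule B) (g v') (g ?e)"
      using v'0 Suc.prems(1) by (intro bimod_hom_add[OF g]) auto
    also have "g v' = tensor_class B (\<Sum>i<n. a i (v' i))"
      using Suc.IH[OF _ v'0] Suc.prems(1) by simp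
    also have "(\<Sum>i<n. a i (v' i)) = (\<Sum>i<n. a i (v i))" by (simp add: v'_def)
    also have "g ?e = tensor_class B (a n (v n))"
      using unit Suc.prems(1) by simp
    finally show ?case by (simp add: tensor_add_class)
  qed
  then show ?thesis using v by simp
qed

text \<open>Unit vectors commute with every scalar, and g is linear over B on both sides, so their
  images lie in T.\<close>

lemma hom_of_unit_vector_central:
  assumes g: "g \<in> bimod_hom C D (power_bimodule N) (tensor_bimodule B)"
    and "B \<subseteq> C" "B \<subseteq> D" "i < N" "g (unit_vector i) = tensor_class B u"
  shows "frag_central B u"
  unfolding frag_central_def
proof
  fix b assume b: "b \<in> B"
  have e: "unit_vector i \<in> carrier (power_bimodule N)"
    using assms(4) by (auto simp: unit_vector_def)
  have "lact (power_bimodule N) b (unit_vector i) = ract (power_bimodule N) (unit_vector i) b"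
    by (auto simp: unit_vector_def)
  then have "lact (tensor_bimodule B) b (g (unit_vector i)) = ract (tensor_bimodule B) (g (unit_vector i)) b"
    using bimod_hom_lact[OF g e, of b] bimod_hom_ract[OF g e, of b] b assms(2,3) by auto
  then show "frag_lact b u - frag_ract u b \<in> tensor_null B"
    by (simp add: assms(5) tensor_lact_class tensor_ract_class tensor_class_eq_iff)
qed

lemma additive_hom_coordinate:
  assumes "f \<in> bimod_hom C D (tensor_bimodule B) (power_bimodule N)"
  shows "additive (\<lambda>t. f (tensor_class B t) i)"
  by standard (simp add: tensor_class_add bimod_hom_add[OF assms] flip: tensor_add_class)

lemma summand_unit_vectors:
  assumes "summand_of_power C D N B" "- 1 \<in> C" "B \<subseteq> C" "B \<subseteq> D"
  obtains f g u where "f \<in> bimod_hom C D (tensor_bimodule B) (power_bimodule N)"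
    and "g \<in> bimod_hom C D (power_bimodule N) (tensor_bimodule B)"
    and "\<And>t. g (f (tensor_class B t)) = tensor_class B t"
    and "\<And>i. i < N \<Longrightarrow> g (unit_vector i) = tensor_class B (u i)"
    and "\<And>i. i < N \<Longrightarrow> frag_central B (u i)"
proof -
  obtain f g where f: "f \<in> bimod_hom C D (tensor_bimodule B) (power_bimodule N)"
    and g: "g \<in> bimod_hom C D (power_bimodule N) (tensor_bimodule B)"
    and gf: "\<And>X. X \<in> carrier (tensor_bimodule B) \<Longrightarrow> g (f X) = X"
    using summand_retraction[OF assms(1,2)] by blast
  have "\<exists>w. i < N \<longrightarrow> g (unit_vector i) = tensor_class B w" for i
  proof (cases "i < N")
    case True
    then have "unit_vector i \<in> carrier (power_bimodule N)" by (auto simp: unit_vector_def)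
    from carrier_tensorE[OF bimod_hom_carrier[OF g this]] show ?thesis by blast
  qed simp
  then obtain u where u: "\<And>i. i < N \<Longrightarrow> g (unit_vector i) = tensor_class B (u i)" by metis
  show thesis
    using that[OF f g] gf u hom_of_unit_vector_central[OF g assms(3,4)] by simp
qed

text \<open>
  The \<open>\<beta>\<^sub>i(y)\<close> are the coordinates of \<open>1 \<otimes> y\<close> under the embedding into \<open>A\<^sup>N\<close>, and the \<open>u\<^sub>i\<close> are the
  images of the unit vectors under the retraction.
\<close>

lemma right_quasi_basis:
  assumes "summand_of_power UNIV B N B"
  obtains \<beta> u where "\<And>i. i < N \<Longrightarrow> \<beta> i \<in> bimod_End B" "\<And>i. i < N \<Longrightarrow> frag_central B (u i)"
    and "\<And>t. t - (\<Sum>i<N. frag_lact (frag_eval id (\<beta> i) t) (u i)) \<in> tensor_null B"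
proof -
  let ?T = "tensor_bimodule B"
  obtain f g u where f: "f \<in> bimod_hom UNIV B ?T (power_bimodule N)"
    and g: "g \<in> bimod_hom UNIV B (power_bimodule N) ?T"
    and gf: "\<And>t. g (f (tensor_class B t)) = tensor_class B t"
    and u: "\<And>i. i < N \<Longrightarrow> g (unit_vector i) = tensor_class B (u i)"
    and central: "\<And>i. i < N \<Longrightarrow> frag_central B (u i)"
    using summand_unit_vectors[OF assms] by blast
  define \<beta> where "\<beta> i y = f (tensor_class B (frag_of (1, y))) i" for i y
  have f_pure: "f (tensor_class B (frag_of (x, y))) i = x * \<beta> i y" for x y i
    using bimod_hom_lact[OF f tensor_class_in_carrier, of x "frag_of (1, y)"]
    by (simp add: \<beta>_def tensor_lact_class frag_lact_def)
  \<comment> \<open>Both sides are additive in t and agree on pure tensors by left A-linearity of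
    f.\<close>
  have f_eval: "f (tensor_class B t) i = frag_eval id (\<beta> i) t" for t i
    by (rule frag_additive_eqI[OF additive_hom_coordinate[OF f] additive_frag_eval])
       (auto simp: f_pure)
  show thesis
  proof (rule that[of \<beta>, OF _ central])
    show "\<beta> i \<in> bimod_End B" for i
      unfolding bimod_End_iff
    proof (intro conjI ballI allI)
      fix x y
      have "tensor_class B (frag_of (1, x + y)) = tensor_class B (frag_of (1, x) + frag_of (1, y))"
        using null_right[of 1 x y B] by (simp add: tensor_class_eq_iff algebra_simps)
      then show "\<beta> i (x + y) = \<beta> i x + \<beta> i y"
        by (simp add: \<beta>_def additive.add[OF additive_hom_coordinate[OF f]])
    next
      fix b x assume b: "b \<in> B"
      \<comment> \<open>Left B-linearity of \<open>\<beta> i\<close> rests on balancedness, 1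
        \<otimes> b x = b \<otimes> x, after which \<open>f_pure\<close> extracts b.\<close>
      have "tensor_class B (frag_of (1, b * x)) = tensor_class B (frag_of (b, x))"
        using tensor_null_minus[OF null_balanced[OF b, of 1 x]] by (simp add: tensor_class_eq_iff)
      then show "\<beta> i (b * x) = b * \<beta> i x"
        using f_pure[of b x i] by (simp add: \<beta>_def)
      show "\<beta> i (x * b) = \<beta> i x * b"
        using bimod_hom_ract[OF f tensor_class_in_carrier b, of "frag_of (1, x)"]
        by (simp add: \<beta>_def tensor_ract_class frag_ract_def)
    qed
    fix t
    have "g (\<lambda>j. if j = i then c else 0) = tensor_class B (frag_lact c (u i))" if "i < N" for i c
    proof -
      have "(\<lambda>j. if j = i then c else 0) = lact (power_bimodule N) c (unit_vector i)"
        by (auto simp: unit_vector_def)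
      moreover have "unit_vector i \<in> carrier (power_bimodule N)"
        using that by (auto simp: unit_vector_def)
      ultimately show ?thesis
        using bimod_hom_lact[OF g, of "unit_vector i" c] u[OF that] by (simp add: tensor_lact_class)
    qed
    from hom_from_power_expansion[OF g this bimod_hom_carrier[OF f tensor_class_in_carrier[of B t]]]
    show "t - (\<Sum>i<N. frag_lact (frag_eval id (\<beta> i) t) (u i)) \<in> tensor_null B"
      unfolding gf by (simp add: f_eval tensor_class_eq_iff)
  qed
qed

text \<open>Mirror image of \<open>right_quasi_basis\<close>, with coordinates of x \<otimes> 1 and
  right A-linearity. Left scalars now range over B only, hence the condition that B contains -
  1.\<close>

lemma left_quasi_basis:
  assumes "summand_of_power B UNIV N B" "- 1 \<in> B"
  obtains \<gamma> u where "\<And>i. i < N \<Longrightarrow> \<gamma> i \<in> bimod_End B" "\<And>i. i < N \<Longrightarrow> frag_central B (u i)"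
    and "\<And>t. t - (\<Sum>i<N. frag_ract (u i) (frag_eval (\<gamma> i) id t)) \<in> tensor_null B"
proof -
  let ?T = "tensor_bimodule B"
  obtain f g u where f: "f \<in> bimod_hom B UNIV ?T (power_bimodule N)"
    and g: "g \<in> bimod_hom B UNIV (power_bimodule N) ?T"
    and gf: "\<And>t. g (f (tensor_class B t)) = tensor_class B t"
    and u: "\<And>i. i < N \<Longrightarrow> g (unit_vector i) = tensor_class B (u i)"
    and central: "\<And>i. i < N \<Longrightarrow> frag_central B (u i)"
    using summand_unit_vectors[OF assms] by blast
  define \<gamma> where "\<gamma> i x = f (tensor_class B (frag_of (x, 1))) i" for i x
  have f_pure: "f (tensor_class B (frag_of (x, y))) i = \<gamma> i x * y" for x y i
    using bimod_hom_ract[OF f tensor_class_in_carrier, of y "frag_of (x, 1)"]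
    by (simp add: \<gamma>_def tensor_ract_class frag_ract_def)
  have f_eval: "f (tensor_class B t) i = frag_eval (\<gamma> i) id t" for t i
    by (rule frag_additive_eqI[OF additive_hom_coordinate[OF f] additive_frag_eval])
       (auto simp: f_pure)
  show thesis
  proof (rule that[of \<gamma>, OF _ central])
    show "\<gamma> i \<in> bimod_End B" for i
      unfolding bimod_End_iff
    proof (intro conjI ballI allI)
      fix x y
      have "tensor_class B (frag_of (x + y, 1)) = tensor_class B (frag_of (x, 1) + frag_of (y, 1))"
        using null_left[of x y 1 B] by (simp add: tensor_class_eq_iff algebra_simps)
      then show "\<gamma> i (x + y) = \<gamma> i x + \<gamma> i y"
        by (simp add: \<gamma>_def additive.add[OF additive_hom_coordinate[OF f]])
    next
      fix b x assume b: "b \<in> B"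
      have "tensor_class B (frag_of (x * b, 1)) = tensor_class B (frag_of (x, b))"
        using null_balanced[OF b, of x 1] by (simp add: tensor_class_eq_iff)
      then show "\<gamma> i (x * b) = \<gamma> i x * b"
        using f_pure[of x b i] by (simp add: \<gamma>_def)
      show "\<gamma> i (b * x) = b * \<gamma> i x"
        using bimod_hom_lact[OF f tensor_class_in_carrier b, of "frag_of (x, 1)"]
        by (simp add: \<gamma>_def tensor_lact_class frag_lact_def)
    qed
    fix t
    have "g (\<lambda>j. if j = i then c else 0) = tensor_class B (frag_ract (u i) c)" if "i < N" for i c
    proof -
      have "(\<lambda>j. if j = i then c else 0) = ract (power_bimodule N) (unit_vector i) c"
        by (auto simp: unit_vector_def)
      moreover have "unit_vector i \<in> carrier (power_bimodule N)"
        using that by (auto simp: unit_vector_def)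
      ultimately show ?thesis
        using bimod_hom_ract[OF g, of "unit_vector i" c] u[OF that] by (simp add: tensor_ract_class)
    qed
    from hom_from_power_expansion[OF g this bimod_hom_carrier[OF f tensor_class_in_carrier[of B t]]]
    show "t - (\<Sum>i<N. frag_ract (u i) (frag_eval (\<gamma> i) id t)) \<in> tensor_null B"
      unfolding gf by (simp add: f_eval tensor_class_eq_iff)
  qed
qed

section \<open>Evaluating and transforming central tensors\<close>

lemma id_bimod_End: "id \<in> bimod_End B"
  by (simp add: bimod_End_iff)

lemma frag_eval_tensor_class_cong:
  assumes "\<alpha> \<in> bimod_End B" "\<beta> \<in> bimod_End B" "u - v \<in> tensor_null B"
  shows "frag_eval \<alpha> \<beta> u = frag_eval \<alpha> \<beta> v"
  using frag_eval_null[OF assms] by simp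

text \<open>Besides proving centrality, this is where irreducibility acts: an element of R lies in B
  and can therefore be pulled past \<alpha>.\<close>

lemma frag_eval_lact_central:
  assumes "\<alpha> \<in> bimod_End B" "r \<in> B"
  shows "frag_eval \<alpha> \<beta> (frag_lact r u) = r * frag_eval \<alpha> \<beta> u"
  using assms by (simp add: frag_eval_frag_lact bimod_End_iff frag_eval_mult_left)

lemma frag_eval_ract_central:
  assumes "\<beta> \<in> bimod_End B" "r \<in> B"
  shows "frag_eval \<alpha> \<beta> (frag_ract u r) = frag_eval \<alpha> \<beta> u * r"
  using assms by (simp add: frag_eval_frag_ract bimod_End_iff frag_eval_mult_right)

text \<open>The evaluation is B-linear on both sides, so it carries T into R.\<close>

lemma frag_eval_central:
  assumes "\<alpha> \<in> bimod_End B" "\<beta> \<in> bimod_End B" "frag_central B u"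
  shows "frag_eval \<alpha> \<beta> u \<in> centralizer B"
  unfolding centralizer_iff
proof
  fix b assume b: "b \<in> B"
  have "frag_eval \<alpha> \<beta> (frag_lact b u) = frag_eval \<alpha> \<beta> (frag_ract u b)"
    using assms(3) b by (intro frag_eval_tensor_class_cong[OF assms(1,2)]) (simp add: frag_central_def)
  then show "b * frag_eval \<alpha> \<beta> u = frag_eval \<alpha> \<beta> u * b"
    using assms(1,2) b by (simp add: frag_eval_lact_central frag_eval_ract_central)
qed

text \<open>The map \<alpha> \<otimes> \<beta> commutes with the outer actions of B and preserves
  the null subgroup, so T is stable under it.\<close>

lemma frag_central_map:
  assumes "\<alpha> \<in> bimod_End B" "\<beta> \<in> bimod_End B" "frag_central B u"
  shows "frag_central B (frag_map \<alpha> \<beta> u)"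
  unfolding frag_central_def
proof
  fix b assume b: "b \<in> B"
  have "left_mult b \<circ> \<alpha> = \<alpha> \<circ> left_mult b" "right_mult b \<circ> \<beta> = \<beta> \<circ> right_mult b"
    using assms(1,2) b by (auto simp: left_mult_def right_mult_def bimod_End_iff)
  then have "frag_lact b (frag_map \<alpha> \<beta> u) - frag_ract (frag_map \<alpha> \<beta> u) b =
      frag_map \<alpha> \<beta> (frag_lact b u - frag_ract u b)"
    by (simp add: frag_lact_eq_map frag_ract_eq_map frag_map_frag_map)
  also have "\<dots> \<in> tensor_null B"
    using assms(3) b by (intro frag_map_null[OF assms(1,2)]) (simp add: frag_central_def)
  finally show "frag_lact b (frag_map \<alpha> \<beta> u) - frag_ract (frag_map \<alpha> \<beta> u) b \<in> tensor_null B" .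
qed

section \<open>The relation defining \<open>\<tau>\<close>\<close>

context
  fixes B :: "'a::{ring, monoid_mult} set" and N :: nat and \<beta> u
  assumes \<beta>: "\<And>i. i < N \<Longrightarrow> \<beta> i \<in> bimod_End B" and u: "\<And>i. i < N \<Longrightarrow> frag_central B (u i)"
    and quasi_basis: "\<And>t. t - (\<Sum>i<N. frag_lact (frag_eval id (\<beta> i) t) (u i)) \<in> tensor_null B"
begin

text \<open>Expanding 1 \<otimes> y in the quasi-basis and evaluating shows that \<delta> is
  determined by its values on the central tensors \<open>u i\<close>.\<close>

lemma right_quasi_basis_reconstruction:
  assumes "\<delta> \<in> bimod_End B"
  shows "\<delta> y = (\<Sum>i<N. \<beta> i y * frag_eval id \<delta> (u i))"
proof -
  have "\<delta> y = frag_eval id \<delta> (frag_of (1, y))" by simp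
  also have "\<dots> = frag_eval id \<delta> (\<Sum>i<N. frag_lact (frag_eval id (\<beta> i) (frag_of (1, y))) (u i))"
    by (rule frag_eval_tensor_class_cong[OF id_bimod_End assms quasi_basis])
  also have "\<dots> = (\<Sum>i<N. \<beta> i y * frag_eval id \<delta> (u i))"
    by (simp add: frag_eval_sum frag_eval_frag_lact frag_eval_mult_left id_def)
  finally show ?thesis .
qed

lemma tau_related_unique_right:
  assumes "\<alpha> \<in> bimod_End B" "\<delta> \<in> bimod_End B" "\<delta>' \<in> bimod_End B"
    and "tau_related B \<alpha> \<delta>" "tau_related B \<alpha> \<delta>'"
  shows "\<delta> = \<delta>'"
proof
  fix y
  have "frag_eval id \<delta> (u i) = frag_eval id \<delta>' (u i)" if "i < N" for i
    using assms u[OF that] by (metis tau_related_iff)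
  then show "\<delta> y = \<delta>' y"
    using assms(2,3) by (simp add: right_quasi_basis_reconstruction)
qed

lemma tau_related_exists_right:
  assumes R: "centralizer B \<subseteq> B" and \<alpha>: "\<alpha> \<in> bimod_End B"
  shows "\<exists>\<delta>\<in>bimod_End B. tau_related B \<alpha> \<delta>"
proof
  \<comment> \<open>This is the reconstruction formula with
    \<open>frag_eval id \<delta> (u i)\<close> replaced by
    \<open>frag_eval \<alpha> id (u i)\<close>, as the desired relation forces.\<close>
  define \<delta> where "\<delta> y = (\<Sum>i<N. \<beta> i y * frag_eval \<alpha> id (u i))" for y
  \<comment> \<open>These values lie in R; commuting with B gives right B-linearity of
    \<delta>.\<close>
  have comm: "b * frag_eval \<alpha> id (u i) = frag_eval \<alpha> id (u i) * b" if "i < N" "b \<in> B" for i b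
    using frag_eval_central[OF \<alpha> id_bimod_End u[OF that(1)]] that(2) by (simp add: centralizer_iff)
  show \<delta>: "\<delta> \<in> bimod_End B"
    unfolding bimod_End_iff
  proof (intro conjI ballI allI)
    show "\<delta> (x + y) = \<delta> x + \<delta> y" for x y
      unfolding \<delta>_def sum.distrib[symmetric]
      by (rule sum.cong) (use \<beta> in \<open>auto simp: bimod_End_iff distrib_right\<close>)
    fix b x assume b: "b \<in> B"
    show "\<delta> (b * x) = b * \<delta> x"
      unfolding \<delta>_def sum_distrib_left
      by (rule sum.cong) (use \<beta> b in \<open>auto simp: bimod_End_iff mult.assoc\<close>)
    show "\<delta> (x * b) = \<delta> x * b"
      unfolding \<delta>_def sum_distrib_right
      by (rule sum.cong) (use \<beta> b comm in \<open>auto simp: bimod_End_iff mult.assoc\<close>)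
  qed
  show "tau_related B \<alpha> \<delta>"
    unfolding tau_related_iff[OF \<alpha> \<delta>]
  proof (intro allI impI)
    fix t assume t: "frag_central B t"
    have "frag_eval \<alpha> id t = frag_eval \<alpha> id (\<Sum>i<N. frag_lact (frag_eval id (\<beta> i) t) (u i))"
      by (rule frag_eval_tensor_class_cong[OF \<alpha> id_bimod_End quasi_basis])
    also have "\<dots> = (\<Sum>i<N. frag_eval id (\<beta> i) t * frag_eval \<alpha> id (u i))"
      unfolding frag_eval_sum
      by (rule sum.cong)
         (use R \<alpha> frag_eval_central[OF id_bimod_End \<beta> t] in \<open>auto intro!: frag_eval_lact_central\<close>)
    also have "\<dots> = frag_eval id \<delta> t"
      by (simp add: \<delta>_def [abs_def] frag_eval_sum_right frag_eval_mult_right)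
    finally show "frag_eval \<alpha> id t = frag_eval id \<delta> t" .
  qed
qed

end

section \<open>Existence and uniqueness of the preimage, from a left quasi-basis\<close>

context
  fixes B :: "'a::{ring, monoid_mult} set" and N :: nat and \<gamma> u
  assumes \<gamma>: "\<And>i. i < N \<Longrightarrow> \<gamma> i \<in> bimod_End B" and u: "\<And>i. i < N \<Longrightarrow> frag_central B (u i)"
    and quasi_basis: "\<And>t. t - (\<Sum>i<N. frag_ract (u i) (frag_eval (\<gamma> i) id t)) \<in> tensor_null B"
begin

lemma left_quasi_basis_reconstruction:
  assumes "\<alpha> \<in> bimod_End B"
  shows "\<alpha> x = (\<Sum>i<N. frag_eval \<alpha> id (u i) * \<gamma> i x)"
proof -
  have "\<alpha> x = frag_eval \<alpha> id (frag_of (x, 1))" by simp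
  also have "\<dots> = frag_eval \<alpha> id (\<Sum>i<N. frag_ract (u i) (frag_eval (\<gamma> i) id (frag_of (x, 1))))"
    by (rule frag_eval_tensor_class_cong[OF assms id_bimod_End quasi_basis])
  also have "\<dots> = (\<Sum>i<N. frag_eval \<alpha> id (u i) * \<gamma> i x)"
    by (simp add: frag_eval_sum frag_eval_frag_ract frag_eval_mult_right id_def)
  finally show ?thesis .
qed

lemma tau_related_unique_left:
  assumes "\<alpha> \<in> bimod_End B" "\<alpha>' \<in> bimod_End B" "\<delta> \<in> bimod_End B"
    and "tau_related B \<alpha> \<delta>" "tau_related B \<alpha>' \<delta>"
  shows "\<alpha> = \<alpha>'"
proof
  fix x
  have "frag_eval \<alpha> id (u i) = frag_eval \<alpha>' id (u i)" if "i < N" for i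
    using assms u[OF that] by (metis tau_related_iff)
  then show "\<alpha> x = \<alpha>' x"
    using assms(1,2) by (simp add: left_quasi_basis_reconstruction)
qed

lemma tau_related_exists_left:
  assumes R: "centralizer B \<subseteq> B" and \<delta>: "\<delta> \<in> bimod_End B"
  shows "\<exists>\<alpha>\<in>bimod_End B. tau_related B \<alpha> \<delta>"
proof
  \<comment> \<open>The witness is again forced: it is
    \<open>left_quasi_basis_reconstruction\<close> with the unknown coefficients rewritten through
    the relation.\<close>
  define \<alpha> where "\<alpha> x = (\<Sum>i<N. frag_eval id \<delta> (u i) * \<gamma> i x)" for x
  have comm: "b * frag_eval id \<delta> (u i) = frag_eval id \<delta> (u i) * b" if "i < N" "b \<in> B" for i b
    using frag_eval_central[OF id_bimod_End \<delta> u[OF that(1)]] that(2) by (simp add: centralizer_iff)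
  show \<alpha>: "\<alpha> \<in> bimod_End B"
    unfolding bimod_End_iff
  proof (intro conjI ballI allI)
    show "\<alpha> (x + y) = \<alpha> x + \<alpha> y" for x y
      unfolding \<alpha>_def sum.distrib[symmetric]
      by (rule sum.cong) (use \<gamma> in \<open>auto simp: bimod_End_iff distrib_left\<close>)
    fix b x assume b: "b \<in> B"
    show "\<alpha> (b * x) = b * \<alpha> x"
      unfolding \<alpha>_def sum_distrib_left
      by (rule sum.cong) (use \<gamma> b comm in \<open>auto simp: bimod_End_iff simp flip: mult.assoc\<close>)
    show "\<alpha> (x * b) = \<alpha> x * b"
      unfolding \<alpha>_def sum_distrib_right
      by (rule sum.cong) (use \<gamma> b in \<open>auto simp: bimod_End_iff mult.assoc\<close>)
  qed
  show "tau_related B \<alpha> \<delta>"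
    unfolding tau_related_iff[OF \<alpha> \<delta>]
  proof (intro allI impI)
    fix t assume t: "frag_central B t"
    have "frag_eval id \<delta> t = frag_eval id \<delta> (\<Sum>i<N. frag_ract (u i) (frag_eval (\<gamma> i) id t))"
      by (rule frag_eval_tensor_class_cong[OF id_bimod_End \<delta> quasi_basis])
    also have "\<dots> = (\<Sum>i<N. frag_eval id \<delta> (u i) * frag_eval (\<gamma> i) id t)"
      \<comment> \<open>Here \<open>frag_eval (\<gamma> i) id t\<close> lies in R, hence in B, so
        right B-linearity of \<delta> lets it leave the second leg.\<close>
      unfolding frag_eval_sum
      by (rule sum.cong)
         (use R \<delta> frag_eval_central[OF \<gamma> id_bimod_End t] in \<open>auto intro!: frag_eval_ract_central\<close>)
    also have "\<dots> = frag_eval \<alpha> id t"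
      by (simp add: \<alpha>_def [abs_def] frag_eval_sum_left frag_eval_mult_left)
    finally show "frag_eval \<alpha> id t = frag_eval id \<delta> t" by simp
  qed
qed

end

section \<open>Compatibility of the relation with composition, multiplications and the unit\<close>

lemma tau_related_comp:
  assumes "\<alpha> \<in> bimod_End B" "\<alpha>' \<in> bimod_End B" "\<beta> \<in> bimod_End B" "\<beta>' \<in> bimod_End B"
    and "tau_related B \<alpha> \<alpha>'" "tau_related B \<beta> \<beta>'"
  shows "tau_related B (\<alpha> \<circ> \<beta>) (\<beta>' \<circ> \<alpha>')"
proof -
  have comp: "\<alpha> \<circ> \<beta> \<in> bimod_End B" "\<beta>' \<circ> \<alpha>' \<in> bimod_End B"
    using assms(1-4) by (simp_all add: bimod_End_iff)
  show ?thesis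
    unfolding tau_related_iff[OF comp]
  proof (intro allI impI)
    fix t assume t: "frag_central B t"
    have "frag_eval (\<alpha> \<circ> \<beta>) id t = frag_eval \<alpha> id (frag_map \<beta> id t)"
      by (simp add: frag_eval_frag_map)
    also have "\<dots> = frag_eval id \<alpha>' (frag_map \<beta> id t)"
      using tau_related_iff[OF assms(1,2)] assms(5) frag_central_map[OF assms(3) id_bimod_End t] by blast
    \<comment> \<open>Both sides evaluate to \<beta>(t1) \<alpha>'(t2) on the legs t1, t2 of t,
      which lets the argument switch from one central tensor to the other.\<close>
    also have "\<dots> = frag_eval \<beta> id (frag_map id \<alpha>' t)"
      by (simp add: frag_eval_frag_map)
    also have "\<dots> = frag_eval id \<beta>' (frag_map id \<alpha>' t)"
      using tau_related_iff[OF assms(3,4)] assms(6) frag_central_map[OF id_bimod_End assms(2) t] by blast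
    also have "\<dots> = frag_eval id (\<beta>' \<circ> \<alpha>') t"
      by (simp add: frag_eval_frag_map)
    finally show "frag_eval (\<alpha> \<circ> \<beta>) id t = frag_eval id (\<beta>' \<circ> \<alpha>') t" .
  qed
qed

lemma left_mult_bimod_End: "r \<in> centralizer B \<Longrightarrow> left_mult r \<in> bimod_End B"
  and right_mult_bimod_End: "r \<in> centralizer B \<Longrightarrow> right_mult r \<in> bimod_End B"
  unfolding bimod_End_iff centralizer_iff left_mult_def right_mult_def
  by (metis distrib_left distrib_right mult.assoc)+

lemma tau_related_right_mult: "tau_related B (right_mult r) (left_mult r)"
  by (simp add: tau_related_def left_mult_def right_mult_def mult.assoc)

text \<open>For central t the product of its legs lies in R, and r in R is an element of B, so the
  two commute.\<close>

lemma tau_related_left_mult: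
  assumes "r \<in> centralizer B" "centralizer B \<subseteq> B"
  shows "tau_related B (left_mult r) (right_mult r)"
  unfolding tau_related_iff[OF left_mult_bimod_End[OF assms(1)] right_mult_bimod_End[OF assms(1)]]
proof (intro allI impI)
  fix t assume t: "frag_central B t"
  have "frag_eval (left_mult r) id t = r * frag_eval id id t"
    using frag_eval_mult_left[of r id id t] by (simp add: left_mult_def [abs_def])
  also have "\<dots> = frag_eval id id t * r"
    using frag_eval_central[OF id_bimod_End id_bimod_End t] subsetD[OF assms(2,1)]
    by (simp add: centralizer_iff)
  also have "\<dots> = frag_eval id (right_mult r) t"
    using frag_eval_mult_right[of id id r t] by (simp add: right_mult_def [abs_def])
  finally show "frag_eval (left_mult r) id t = frag_eval id (right_mult r) t" .
qed

text \<open>The tensor 1 \<otimes> 1 is central because balancedness gives b \<otimes> 1 = 1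
  \<otimes> b; it is the test element.\<close>

lemma tau_related_at_one:
  assumes "tau_related B \<alpha> \<delta>"
  shows "\<delta> 1 = \<alpha> 1"
proof -
  have "frag_central B (frag_of (1, 1))"
    using null_balanced[of _ B 1 1] by (simp add: frag_central_def frag_lact_def frag_ract_def)
  then have "tensor_sum B [(1, 1)] \<in> tensor_central B"
    by (simp add: tensor_sum_def tensor_class_central_iff)
  with assms have "(\<Sum>(x, y)\<leftarrow>[(1, 1)]. \<alpha> x * y) = (\<Sum>(x, y)\<leftarrow>[(1, 1)]. x * \<delta> y)"
    unfolding tau_related_def by blast
  then show ?thesis by simp
qed

text \<open>Negation is not listed in \<open>unital_subalgebra\<close>, but - 1 is the scalar - 1
  acting on the unit.\<close>

lemma minus_one_in_subalgebra:
  assumes "K_algebra scale" "unital_subalgebra scale B"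
  shows "- 1 \<in> B"
proof -
  interpret K_algebra scale by fact
  have "scale 0 1 = 0" using scale_left_distrib[of 0 0 1] by simp
  then have "scale (- 1) 1 = - 1"
    using scale_left_distrib[of "- 1" 1 1] by (simp add: scale_one eq_neg_iff_add_eq_0)
  then show ?thesis using assms(2) unfolding unital_subalgebra_def by metis
qed

section \<open>Assembling the anti-automorphism\<close>

theorem lemma3p1:
  fixes scale :: "'k::{comm_ring, comm_monoid_mult} \<Rightarrow> 'a::{ring, monoid_mult} \<Rightarrow> 'a"
    and B :: "'a set"
  assumes "K_algebra scale"
    and "unital_subalgebra scale B"
    and "irreducible_extension B"
  shows "(\<forall>\<alpha>\<in>bimod_End B. \<exists>!\<beta>. \<beta> \<in> bimod_End B \<and> tau_related B \<alpha> \<beta>) \<and>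
    algebra_anti_automorphism scale (bimod_End B) (tau B) \<and>
    (\<forall>r\<in>centralizer B. tau B (right_mult r) = left_mult r \<and> tau B (left_mult r) = right_mult r) \<and>
    (\<forall>\<alpha>\<in>bimod_End B. tau B \<alpha> 1 = \<alpha> 1)"
proof -
  interpret K_algebra scale by fact
  let ?S = "bimod_End B"
  obtain N where left: "summand_of_power B UNIV N B" and right: "summand_of_power UNIV B N B"
    and R: "centralizer B \<subseteq> B"
    using assms(3) unfolding irreducible_extension_def depth_two_def by blast
  obtain \<beta> u where rqb: "\<And>i. i < N \<Longrightarrow> \<beta> i \<in> ?S" "\<And>i. i < N \<Longrightarrow> frag_central B (u i)"
    "\<And>t. t - (\<Sum>i<N. frag_lact (frag_eval id (\<beta> i) t) (u i)) \<in> tensor_null B"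
    using right_quasi_basis[OF right] by blast
  obtain \<gamma> v where lqb: "\<And>i. i < N \<Longrightarrow> \<gamma> i \<in> ?S" "\<And>i. i < N \<Longrightarrow> frag_central B (v i)"
    "\<And>t. t - (\<Sum>i<N. frag_ract (v i) (frag_eval (\<gamma> i) id t)) \<in> tensor_null B"
    using left_quasi_basis[OF left minus_one_in_subalgebra[OF assms(1,2)]] by blast
  have ex1: "\<exists>!\<delta>. \<delta> \<in> ?S \<and> tau_related B \<alpha> \<delta>" if "\<alpha> \<in> ?S" for \<alpha>
    using tau_related_exists_right[OF rqb R that] tau_related_unique_right[OF rqb that] by blast
  have tau: "tau B \<alpha> \<in> ?S" "tau_related B \<alpha> (tau B \<alpha>)" if "\<alpha> \<in> ?S" for \<alpha>
    using theI'[OF ex1[OF that]] by (simp_all add: tau_def)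
  \<comment> \<open>Unique existence justifies the description operator in \<open>tau\<close>. The
    formulas for tau below then follow by exhibiting a related element of S.\<close>
  have tau_eqI: "tau B \<alpha> = \<delta>" if "\<alpha> \<in> ?S" "\<delta> \<in> ?S" "tau_related B \<alpha> \<delta>" for \<alpha> \<delta>
    using ex1[OF that(1)] tau[OF that(1)] that by blast
  have scale_End: "(\<lambda>a. scale k (\<alpha> a)) \<in> ?S" if "\<alpha> \<in> ?S" for k \<alpha>
    using that by (simp add: bimod_End_iff scale_right_distrib flip: scale_mult_left scale_mult_right)
  have add_End: "(\<lambda>a. \<alpha> a + \<delta> a) \<in> ?S" if "\<alpha> \<in> ?S" "\<delta> \<in> ?S" for \<alpha> \<delta>
    using that by (simp add: bimod_End_iff algebra_simps)
  \<comment> \<open>Injectivity and surjectivity are the uniqueness and existence of preimages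
    provided by the left quasi-basis.\<close>
  have bij: "bij_betw (tau B) ?S ?S"
  proof (rule bij_betwI')
    fix \<alpha> \<alpha>' assume "\<alpha> \<in> ?S" "\<alpha>' \<in> ?S"
    then show "(tau B \<alpha> = tau B \<alpha>') = (\<alpha> = \<alpha>')"
      using tau tau_related_unique_left[OF lqb] by metis
  next
    fix \<delta> assume "\<delta> \<in> ?S"
    then show "\<exists>\<alpha>\<in>?S. \<delta> = tau B \<alpha>"
      using tau_related_exists_left[OF lqb R] tau_eqI by metis
  qed (rule tau)
  have add: "tau B (\<lambda>a. \<alpha> a + \<delta> a) = (\<lambda>a. tau B \<alpha> a + tau B \<delta> a)"
    if "\<alpha> \<in> ?S" "\<delta> \<in> ?S" for \<alpha> \<delta>
  proof (rule tau_eqI)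
    show "tau_related B (\<lambda>a. \<alpha> a + \<delta> a) (\<lambda>a. tau B \<alpha> a + tau B \<delta> a)"
      using tau[OF that(1)] tau[OF that(2)] that
      by (simp add: tau_related_iff add_End frag_eval_add_left frag_eval_add_right)
  qed (use that tau in \<open>simp_all add: add_End\<close>)
  have scale: "tau B (\<lambda>a. scale k (\<alpha> a)) = (\<lambda>a. scale k (tau B \<alpha> a))" if "\<alpha> \<in> ?S" for k \<alpha>
  proof (rule tau_eqI)
    \<comment> \<open>Base case for lists: scalars then pull out of both sums, so the relation is
      checked directly on lists of pure tensors.\<close>
    have "scale k 0 = 0"
      using scale_right_distrib[of k 0 0] by simp
    then have "(\<Sum>(x, y)\<leftarrow>ps. scale k (\<alpha> x) * y) = scale k (\<Sum>(x, y)\<leftarrow>ps. \<alpha> x * y)"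
      "(\<Sum>(x, y)\<leftarrow>ps. x * scale k (\<delta> y)) = scale k (\<Sum>(x, y)\<leftarrow>ps. x * \<delta> y)" for ps \<alpha> \<delta>
      by (induction ps) (auto simp: scale_right_distrib simp flip: scale_mult_left scale_mult_right)
    then show "tau_related B (\<lambda>a. scale k (\<alpha> a)) (\<lambda>a. scale k (tau B \<alpha> a))"
      using tau[OF that] by (simp add: tau_related_def)
  qed (use that tau in \<open>simp_all add: scale_End\<close>)
  have comp: "tau B (\<alpha> \<circ> \<delta>) = tau B \<delta> \<circ> tau B \<alpha>" if "\<alpha> \<in> ?S" "\<delta> \<in> ?S" for \<alpha> \<delta>
  proof (rule tau_eqI)
    show "tau_related B (\<alpha> \<circ> \<delta>) (tau B \<delta> \<circ> tau B \<alpha>)"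
      using that tau by (intro tau_related_comp)
  qed (use that tau in \<open>simp_all add: bimod_End_iff\<close>)
  have "tau B id = id"
    by (rule tau_eqI[OF id_bimod_End id_bimod_End]) (simp add: tau_related_def)
  with bij add scale comp have "algebra_anti_automorphism scale ?S (tau B)"
    by (simp add: algebra_anti_automorphism_def)
  moreover have "tau B (right_mult r) = left_mult r \<and> tau B (left_mult r) = right_mult r"
    if "r \<in> centralizer B" for r
    using that R
    by (simp add: tau_eqI left_mult_bimod_End right_mult_bimod_End tau_related_left_mult tau_related_right_mult)
  moreover have "tau B \<alpha> 1 = \<alpha> 1" if "\<alpha> \<in> ?S" for \<alpha>
    by (rule tau_related_at_one[OF tau(2)[OF that]])
  ultimately show ?thesis using ex1 by blast
qed

end
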